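(* Let two skew linear varieties $$V_{\vec b} := \{\vec b + B\vec u : \vec u \in \mathbb{R}^{l_1}\}, \qquad V_{\vec c} := \{\vec c - C\vec v : \vec v \in \mathbb{R}^{l_2}\}$$ be given, where $\vec b$ and $\vec c$ are given vectors in $\mathbb{R}^m$ and $B$ and $C$ are real matrices of type $m\times l_1$ and $m\times l_2$, respectively. Then the best approximation pair $(\vec b^{*}, \vec c^{*}) \in V_{\vec b}\times V_{\vec c}$ is given by $$\vec b^{*} = \vec b + B\vec u^{*} \quad\text{and}\quad \vec c^{*} = \vec c - C\vec v^{*},$$ where $$\begin{bmatrix} \vec u^{*} \\ \vec v^{*}\end{bmatrix} := \vec x^{*} = A^{\dagger}\vec d,$$ with $A = [B \mid C] \in \mathbb{R}^{m\times(l_1+l_2)}$ (the matrix whose first $l_1$ columns are those of $B$ and whose last $l_2$ columns are those of $C$), $\vec d = \vec c - \vec b$, $\vec u^{*}\in\mathbb{R}^{l_1}$, $\vec v^{*}\in\mathbb{R}^{l_2}$, and $A^\dagger$ the Moore-Penrose inverse of $A$. Furthermore, the distance between $V_{\vec b}$ and $V_{\vec c}$ is $d(V_{\vec b}, V_{\vec c}) = \|\vec b^{*} - \vec c^{*}\|$.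
   Context: $\|\cdot\|$ is the Euclidean norm on $\mathbb{R}^m$. The Euclidean distance $d(V_{\vec b},V_{\vec c})$ is the minimum of $\|\vec b + B\vec u - \vec c + C\vec v\|$ over $\vec u\in\mathbb{R}^{l_1}$, $\vec v\in\mathbb{R}^{l_2}$. The best approximation pair of the linear varieties $V_{\vec b}$ and $V_{\vec c}$ is the pair $(\vec b^{*},\vec c^{*})\in V_{\vec b}\times V_{\vec c}$ such that $\|\vec b^{*}-\vec c^{*}\| = d(V_{\vec b},V_{\vec c})$. Skew means non-intersecting and non-parallel. The Moore-Penrose inverse $M^\dagger$ of a real matrix $M$ is the unique matrix satisfying $MM^\dagger M = M$, $M^\dagger M M^\dagger = M^\dagger$, $(MM^\dagger)^T = MM^\dagger$ and $(M^\dagger M)^T = M^\dagger M$, where $T$ stands for matrix transposition.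
   Formalization: Uniqueness of the best approximation pair is claimed only when the column spaces of B and C meet only in 0; otherwise it fails, e.g. for span(e1,e2) and e4+span(e1,e3) in R^4. That the given pair attains the distance is claimed without this condition. *)

theory Defs
  imports "HOL-Analysis.Analysis"
begin

text \<open>
  Two sets of points are skew if they are disjoint and not parallel.  \<open>affine_parallel\<close> means
  that one is a translate of the other, so for affine subspaces: same direction space.
\<close>

definition skew :: "'a::real_vector set \<Rightarrow> 'a set \<Rightarrow> bool" where
  "skew S T \<longleftrightarrow> S \<inter> T = {} \<and> \<not> affine_parallel S T"

text \<open>
  \<open>setdist\<close> is an infimum; a best approximation pair is one where it is attained.
\<close>

definition best_approximation_pair ::
    "'a::real_normed_vector set \<Rightarrow> 'a set \<Rightarrow> 'a \<Rightarrow> 'a \<Rightarrow> bool" where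
  "best_approximation_pair S T p q \<longleftrightarrow> p \<in> S \<and> q \<in> T \<and> norm (p - q) = setdist S T"

lemma setdist_linear_varieties:
  fixes b c :: "real ^ 'm" and B :: "real ^ 'l1 ^ 'm" and C :: "real ^ 'l2 ^ 'm"
  shows "setdist {b + B *v u | u. True} {c - C *v v | v. True} =
         Inf {norm (b + B *v u - c + C *v v) | u v. True}"
proof -
  have "dist (b + B *v u) (c - C *v v) = norm (b + B *v u - c + C *v v)" for u v
    by (simp add: dist_norm algebra_simps)
  then have "{dist x y | x y. x \<in> {b + B *v u | u. True} \<and> y \<in> {c - C *v v | v. True}} =
        {norm (b + B *v u - c + C *v v) | u v. True}"
    by (simp add: set_eq_iff) metis
  then show ?thesis
    by (auto simp: setdist_def)
qed

definition is_moore_penrose_inverse :: "real ^ 'n ^ 'm \<Rightarrow> real ^ 'm ^ 'n \<Rightarrow> bool" where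
  "is_moore_penrose_inverse M X \<longleftrightarrow>
     M ** X ** M = M \<and> X ** M ** X = X \<and>
     transpose (M ** X) = M ** X \<and> transpose (X ** M) = X ** M"

definition moore_penrose_inverse :: "real ^ 'n ^ 'm \<Rightarrow> real ^ 'm ^ 'n" where
  "moore_penrose_inverse M = (THE X. is_moore_penrose_inverse M X)"

text \<open>
  The block matrix \<open>[B | C]\<close>: columns are indexed by the sum type, \<open>Inl\<close> for the columns of
  \<open>B\<close> and \<open>Inr\<close> for those of \<open>C\<close>.
\<close>

definition hblock :: "real ^ 'k ^ 'm \<Rightarrow> real ^ 'l ^ 'm \<Rightarrow> real ^ ('k::finite + 'l::finite) ^ 'm" where
  "hblock B C = (\<chi> i j. case j of Inl k \<Rightarrow> B $ i $ k | Inr l \<Rightarrow> C $ i $ l)"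

definition upper_part :: "real ^ ('k::finite + 'l::finite) \<Rightarrow> real ^ 'k" where
  "upper_part x = (\<chi> i. x $ Inl i)"

definition lower_part :: "real ^ ('k::finite + 'l::finite) \<Rightarrow> real ^ 'l" where
  "lower_part x = (\<chi> j. x $ Inr j)"

end

theory Submission
  imports Defs
begin

text \<open>
  With \<open>A = [B | C]\<close> and \<open>d = c - b\<close>, the difference of \<open>b + B u\<close> and \<open>c - C v\<close> is \<open>A x - d\<close> for
  the stacked vector \<open>x = (u, v)\<close>, so a best approximation pair is a least squares solution of
  \<open>A x = d\<close>.  The residual of \<open>x = A\<^sup>\<dagger> d\<close> is orthogonal to the range of \<open>A\<close> because
  \<open>A\<^sup>T A A\<^sup>\<dagger> = A\<^sup>T\<close>, and Pythagoras gives minimality, strict unless \<open>A x = A A\<^sup>\<dagger> d\<close>.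
\<close>

text \<open>Some linear map is a right inverse of \<open>M\<close> on its range; its matrix serves
  as \<open>G\<close>.\<close>

lemma ex_generalized_inverse:
  fixes M :: "real ^ 'n ^ 'm"
  shows "\<exists>G :: real ^ 'm ^ 'n. M ** G ** M = M"
proof -
  obtain g where g: "linear g" "\<And>x. M *v g (M *v x) = M *v x"
    using linear_exists_right_inverse_on[of "(*v) M" UNIV] by auto
  have "(M ** matrix g ** M) *v x = M *v x" for x
    using g by (simp add: matrix_works flip: matrix_vector_mul_assoc)
  then show ?thesis
    unfolding matrix_eq by blast
qed

text \<open>If \<open>transpose A ** A\<close> kills \<open>z\<close>, then the squared norm of
  \<open>A *v z\<close>, which is the inner product of \<open>z\<close> with
  \<open>transpose A *v (A *v z)\<close>, vanishes.\<close>

lemma gram_matrix_cancel: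
  fixes A :: "real ^ 'n ^ 'm" and X Y :: "real ^ 'k ^ 'n"
  assumes "transpose A ** A ** X = transpose A ** A ** Y"
  shows "A ** X = A ** Y"
proof -
  have "A *v (X *v x) = A *v (Y *v x)" for x
  proof -
    let ?z = "X *v x - Y *v x"
    have "transpose A *v (A *v ?z) = 0"
      using arg_cong[OF assms, of "\<lambda>M. M *v x"]
      by (simp add: matrix_vector_mult_diff_distrib flip: matrix_vector_mul_assoc)
    then have "(A *v ?z) \<bullet> (A *v ?z) = 0"
      by (metis dot_lmul_matrix inner_zero_left matrix_transpose_mul transpose_matrix_vector)
    then show ?thesis
      by (simp add: matrix_vector_mult_diff_distrib)
  qed
  then show ?thesis
    by (simp add: matrix_eq flip: matrix_vector_mul_assoc)
qed

text \<open>
  \<open>A L\<close> is the orthogonal projection onto the range of \<open>A\<close>, written as \<open>A (A\<^sup>T A)\<^sup>- A\<^sup>T\<close> for a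
  generalized inverse \<open>(A\<^sup>T A)\<^sup>-\<close>.
\<close>

lemma ex_least_squares_inverse:
  fixes A :: "real ^ 'n ^ 'm"
  shows "\<exists>L :: real ^ 'm ^ 'n. A ** L ** A = A \<and> transpose (A ** L) = A ** L"
proof -
  obtain G where G: "transpose A ** A ** G ** (transpose A ** A) = transpose A ** A"
    using ex_generalized_inverse by blast
  define L where "L = G ** transpose A"
  define P where "P = A ** L"
  have "A ** (L ** A) = A ** mat 1"
    by (rule gram_matrix_cancel) (use G in \<open>simp add: L_def matrix_mul_assoc\<close>)
  then have PA: "P ** A = A"
    by (simp add: P_def matrix_mul_assoc)
  have "transpose P = A ** transpose G ** transpose A"
    by (simp add: P_def L_def matrix_transpose_mul matrix_mul_assoc)
  \<comment> \<open>\<open>transpose P\<close> has \<open>A\<close> as its left factor, and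
    \<open>P ** A = A\<close>. Since \<open>P ** transpose P\<close> is symmetric, so is
    \<open>P\<close>.\<close>
  then have "P ** transpose P = transpose P"
    by (simp add: matrix_mul_assoc PA)
  then have "transpose P = P"
    by (metis matrix_transpose_mul transpose_transpose)
  with PA show ?thesis
    unfolding P_def by blast
qed

text \<open>\<open>L\<close> makes \<open>A ** L\<close> symmetric; \<open>R\<close>, obtained by
  transposing such an inverse of \<open>transpose A\<close>, makes \<open>R ** A\<close> symmetric.
  The product \<open>R ** A ** L\<close> inherits both properties.\<close>

lemma ex_moore_penrose_inverse:
  fixes A :: "real ^ 'n ^ 'm"
  shows "\<exists>X. is_moore_penrose_inverse A X"
proof -
  obtain L :: "real ^ 'm ^ 'n" where L: "A ** L ** A = A" "transpose (A ** L) = A ** L"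
    using ex_least_squares_inverse by blast
  obtain K where K: "transpose A ** K ** transpose A = transpose A"
      "transpose (transpose A ** K) = transpose A ** K"
    using ex_least_squares_inverse by blast
  define R where "R = transpose K"
  have R: "A ** R ** A = A" "transpose (R ** A) = R ** A"
    using arg_cong[OF K(1), of transpose] K(2)
    by (simp_all add: R_def matrix_transpose_mul matrix_mul_assoc)
  define X where "X = R ** A ** L"
  have AX: "A ** X = A ** L" and XA: "X ** A = R ** A"
    using L(1) R(1) by (simp_all add: X_def matrix_mul_assoc) (metis matrix_mul_assoc)
  have "X ** A ** X = X"
    by (metis AX XA X_def R(1) matrix_mul_assoc)
  with L R AX XA show ?thesis
    unfolding is_moore_penrose_inverse_def by metis
qed

text \<open>\<open>A ** X\<close> and \<open>A ** Y\<close> are both the orthogonal projection onto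
  the range of \<open>A\<close>, and \<open>X ** A = Y ** A\<close> follows likewise. Hence
  \<open>X = X ** A ** X = Y ** A ** Y = Y\<close>.\<close>

lemma moore_penrose_inverse_unique:
  fixes A :: "real ^ 'n ^ 'm"
  assumes "is_moore_penrose_inverse A X" "is_moore_penrose_inverse A Y"
  shows "X = Y"
proof -
  have X: "A ** X ** A = A" "X ** A ** X = X"
      "transpose (A ** X) = A ** X" "transpose (X ** A) = X ** A"
    and Y: "A ** Y ** A = A" "Y ** A ** Y = Y"
      "transpose (A ** Y) = A ** Y" "transpose (Y ** A) = Y ** A"
    using assms unfolding is_moore_penrose_inverse_def by auto
  \<comment> \<open>Each projection absorbs the other on its right; transposing swaps the order of
    the factors.\<close>
  have "A ** X = transpose (A ** Y ** (A ** X))"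
    by (simp add: matrix_mul_assoc X Y)
  also have "\<dots> = A ** X ** (A ** Y)"
    by (simp add: matrix_transpose_mul[of "A ** Y"] X Y)
  also have "\<dots> = A ** Y"
    by (simp add: matrix_mul_assoc X)
  finally have AX: "A ** X = A ** Y" .
  have "X ** A = transpose (X ** A ** (Y ** A))"
    using X Y by (metis matrix_mul_assoc)
  also have "\<dots> = Y ** A ** (X ** A)"
    by (simp add: matrix_transpose_mul[of "X ** A"] X Y)
  also have "\<dots> = Y ** A"
    using X by (metis matrix_mul_assoc)
  finally have "X ** A = Y ** A" .
  with AX X Y show ?thesis
    by (metis matrix_mul_assoc)
qed

lemma is_moore_penrose_inverse_moore_penrose_inverse:
  "is_moore_penrose_inverse A (moore_penrose_inverse A)"
  unfolding moore_penrose_inverse_def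
  using ex_moore_penrose_inverse moore_penrose_inverse_unique by (metis theI)

text \<open>By symmetry \<open>A ** moore_penrose_inverse A\<close> moves to the other argument of
  the inner product, where it fixes \<open>A *v y\<close>.\<close>

lemma moore_penrose_residual_orthogonal:
  fixes A :: "real ^ 'n ^ 'm"
  shows "(A *v (moore_penrose_inverse A *v d) - d) \<bullet> (A *v y) = 0"
proof -
  let ?X = "moore_penrose_inverse A"
  have X: "A ** ?X ** A = A" "transpose (A ** ?X) = A ** ?X"
    using is_moore_penrose_inverse_moore_penrose_inverse[of A]
    unfolding is_moore_penrose_inverse_def by auto
  have "(A *v (?X *v d)) \<bullet> (A *v y) = d \<bullet> (transpose (A ** ?X) *v (A *v y))"
    by (metis dot_lmul_matrix matrix_vector_mul_assoc transpose_matrix_vector X(2))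
  also have "\<dots> = d \<bullet> (A *v y)"
    by (simp add: X matrix_vector_mul_assoc)
  finally show ?thesis
    by (simp add: inner_diff_left)
qed

lemma moore_penrose_pythagoras:
  fixes A :: "real ^ 'n ^ 'm"
  shows "(norm (A *v x - d))\<^sup>2 =
    (norm (A *v (moore_penrose_inverse A *v d) - d))\<^sup>2 +
    (norm (A *v x - A *v (moore_penrose_inverse A *v d)))\<^sup>2"
proof -
  let ?s = "moore_penrose_inverse A *v d"
  have "A *v x - d = (A *v ?s - d) + A *v (x - ?s)"
    by (simp add: matrix_vector_mult_diff_distrib)
  moreover have "orthogonal (A *v ?s - d) (A *v (x - ?s))"
    unfolding orthogonal_def by (rule moore_penrose_residual_orthogonal)
  ultimately show ?thesis
    by (metis norm_add_Pythagorean matrix_vector_mult_diff_distrib)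
qed

lemma hblock_mult_vector:
  "hblock B C *v x = B *v upper_part x + C *v lower_part x"
  unfolding hblock_def upper_part_def lower_part_def matrix_vector_mult_def vec_eq_iff
  by (simp add: sum.Plus flip: UNIV_Plus_UNIV)

lemma ex_stacked_vector:
  fixes u :: "real ^ 'k::finite" and v :: "real ^ 'l::finite"
  obtains x where "upper_part x = u" "lower_part x = v"
proof
  let ?x = "\<chi> i. case i of Inl k \<Rightarrow> u $ k | Inr l \<Rightarrow> v $ l"
  show "upper_part ?x = u" "lower_part ?x = v"
    by (simp_all add: upper_part_def lower_part_def vec_eq_iff)
qed

text \<open>Skew varieties may share a direction, and moving both points of a best pair along it
  keeps their distance. Uniqueness is therefore stated for ranges that meet only in 0.\<close>

theorem proposition2p2:
  fixes b c d bstar cstar :: "real ^ 'm"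
    and B :: "real ^ 'l1 ^ 'm"
    and C :: "real ^ 'l2 ^ 'm"
    and A :: "real ^ ('l1::finite + 'l2::finite) ^ 'm"
    and xstar :: "real ^ ('l1 + 'l2)"
    and ustar :: "real ^ 'l1"
    and vstar :: "real ^ 'l2"
    and Vb Vc :: "(real ^ 'm) set"
  assumes "Vb = {b + B *v u | u. True}"
    and "Vc = {c - C *v v | v. True}"
    and "skew Vb Vc"
    and "A = hblock B C"
    and "d = c - b"
    and "xstar = moore_penrose_inverse A *v d"
    and "ustar = upper_part xstar"
    and "vstar = lower_part xstar"
    and "bstar = b + B *v ustar"
    and "cstar = c - C *v vstar"
  shows "best_approximation_pair Vb Vc bstar cstar \<and>
         (range ((*v) B) \<inter> range ((*v) C) = {0} \<longrightarrow>
            (\<forall>p q. best_approximation_pair Vb Vc p q \<longrightarrow> p = bstar \<and> q = cstar)) \<and>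
         setdist Vb Vc = norm (bstar - cstar)"
proof -
  have stacked: "\<exists>x. p = b + B *v upper_part x \<and> q = c - C *v lower_part x"
    if pq: "p \<in> Vb" "q \<in> Vc" for p q
  proof -
    obtain u v where uv: "p = b + B *v u" "q = c - C *v v"
      using pq assms(1,2) by auto
    obtain x where "upper_part x = u" "lower_part x = v"
      by (rule ex_stacked_vector)
    with uv show ?thesis
      by blast
  qed
  have diff: "b + B *v upper_part x - (c - C *v lower_part x) = A *v x - d" for x
    using assms(4,5) by (simp add: hblock_mult_vector algebra_simps)
  have star_diff: "bstar - cstar = A *v xstar - d"
    using diff assms(7-10) by simp
  have pythagoras: "(norm (A *v x - d))\<^sup>2 =
      (norm (bstar - cstar))\<^sup>2 + (norm (A *v x - A *v xstar))\<^sup>2" for x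
    using moore_penrose_pythagoras[of A x d] star_diff assms(6) by simp
  have mem: "bstar \<in> Vb" "cstar \<in> Vc"
    using assms by auto
  have "norm (bstar - cstar) \<le> dist p q" if pq: "p \<in> Vb" "q \<in> Vc" for p q
  proof -
    obtain x where "p = b + B *v upper_part x" "q = c - C *v lower_part x"
      using stacked pq by blast
    then have "dist p q = norm (A *v x - d)"
      by (simp add: dist_norm diff)
    with pythagoras[of x] show ?thesis
      by (metis le_add_same_cancel1 norm_ge_zero power2_le_imp_le zero_le_power2)
  qed
  then have "norm (bstar - cstar) \<le> setdist Vb Vc"
    using mem by (intro le_setdistI) auto
  moreover have "setdist Vb Vc \<le> norm (bstar - cstar)"
    using setdist_le_dist[OF mem] by (simp add: dist_norm)
  ultimately have dist: "setdist Vb Vc = norm (bstar - cstar)"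
    by simp
  have "p = bstar \<and> q = cstar"
    if indep: "range ((*v) B) \<inter> range ((*v) C) = {0}"
      and best: "best_approximation_pair Vb Vc p q" for p q
  proof -
    obtain x where x: "p = b + B *v upper_part x" "q = c - C *v lower_part x"
      using stacked best unfolding best_approximation_pair_def by blast
    have "norm (A *v x - d) = norm (bstar - cstar)"
      using best dist unfolding best_approximation_pair_def x diff by simp
    with pythagoras[of x] have "A *v x = A *v xstar"
      by simp
    \<comment> \<open>The two sides are the displacements \<open>p - bstar\<close> and
      \<open>q - cstar\<close>; their common value lies in both ranges.\<close>
    then have eq: "B *v (upper_part x - ustar) = C *v (vstar - lower_part x)"
      using assms(4,7,8)
      by (simp add: hblock_mult_vector matrix_vector_mult_diff_distrib algebra_simps)
    then have "B *v (upper_part x - ustar) \<in> range ((*v) B) \<inter> range ((*v) C)"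
      by (metis IntI rangeI)
    then have "B *v (upper_part x - ustar) = 0"
      using indep by auto
    with eq x assms(9,10) show ?thesis
      by (simp add: matrix_vector_mult_diff_distrib)
  qed
  with dist mem show ?thesis
    unfolding best_approximation_pair_def by auto
qed

end
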